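(* Let $x\in\mathbb{R}^p_+$ with $F_X(x)>0$, and suppose there are constants $b_n>0$ and a non-degenerate distribution function $G_x$ such that $b_n^{-1}(\hat\varphi_1(x)-\varphi(x))\stackrel{d}{\longrightarrow}G_x$ as $n\to\infty$. (i) For any fixed integer $k\ge0$, $$b_n^{-1}\bigl(\hat\varphi_{1-k/(n\hat F_X(x))}(x)-\varphi(x)\bigr)\stackrel{d}{\longrightarrow}H_x\qquad\text{as } n\to\infty,$$ where $H_x$ is the distribution function $H_x(y)=G_x(y)\sum_{i=0}^k\frac{(-\log G_x(y))^i}{i!}$ (with $H_x(y)=0$ when $G_x(y)=0$). (ii) If, in addition, the upper bound of the support of $Y$ is finite, then $$b_n^{-1}\bigl(\hat\varphi_{\alpha_n}(x)-\varphi(x)\bigr)\stackrel{d}{\longrightarrow}G_x$$ for all sequences $\alpha_n\in(0,1]$ with $\alpha_n\to1$ satisfying $n b_n^{-1}(1-\alpha_n)\to0$.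
   Context: $(X,Y)$ is a random vector in $\mathbb{R}^p_+\times\mathbb{R}_+$ with joint distribution function $F(x,y)=\mathbb{P}(X\le x,Y\le y)$ (inequalities between vectors are componentwise), and $(X_i,Y_i)$, $i=1,\dots,n$, are i.i.d. copies of $(X,Y)$. Put $F_X(x)=F(x,\infty)$ and, for $F_X(x)>0$, $F(y|x)=F(x,y)/F_X(x)$. The frontier function is $\varphi(x)=\sup\{y\ge0: F(y|x)<1\}$, assumed finite. The empirical versions are $\hat F_n(x,y)=\frac1n\sum_{i=1}^n\mathbf{1}(X_i\le x,Y_i\le y)$, $\hat F_X(x)=\hat F_n(x,\infty)$, $\hat F(y|x)=\hat F_n(x,y)/\hat F_X(x)$, and for $\alpha\in(0,1]$, $\hat\varphi_\alpha(x)=\inf\{y\ge0:\hat F(y|x)\ge\alpha\}$. In particular $\hat\varphi_1(x)=\max_{i:X_i\le x}Y_i$ is the FDH estimator. All these quantities are well defined, with probability one, for $n$ large enough. *)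

theory Defs
  imports "HOL-Probability.Probability"
begin

text \<open>Vector inequalities are the library order on \<^typ>\<open>real ^ 'p\<close>, which is componentwise.\<close>

definition joint_df ::
  "'a measure \<Rightarrow> ('a \<Rightarrow> real ^ 'p) \<Rightarrow> ('a \<Rightarrow> real) \<Rightarrow> real ^ 'p \<Rightarrow> real \<Rightarrow> real" where
  "joint_df M X Y x y = measure M {\<omega> \<in> space M. X \<omega> \<le> x \<and> Y \<omega> \<le> y}"

text \<open>This is $F(x,\infty)$.\<close>

definition marginal_df :: "'a measure \<Rightarrow> ('a \<Rightarrow> real ^ 'p) \<Rightarrow> real ^ 'p \<Rightarrow> real" where
  "marginal_df M X x = measure M {\<omega> \<in> space M. X \<omega> \<le> x}"

definition cond_df ::
  "'a measure \<Rightarrow> ('a \<Rightarrow> real ^ 'p) \<Rightarrow> ('a \<Rightarrow> real) \<Rightarrow> real ^ 'p \<Rightarrow> real \<Rightarrow> real" where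
  "cond_df M X Y x y = joint_df M X Y x y / marginal_df M X x"

text \<open>The supremum is taken in $[0,\infty]$, so that finiteness is a genuine condition and the
  supremum of the empty set is 0.\<close>

definition frontier_fun ::
  "'a measure \<Rightarrow> ('a \<Rightarrow> real ^ 'p) \<Rightarrow> ('a \<Rightarrow> real) \<Rightarrow> real ^ 'p \<Rightarrow> ennreal" where
  "frontier_fun M X Y x = (SUP y \<in> {y. 0 \<le> y \<and> cond_df M X Y x y < 1}. ennreal y)"

text \<open>The sample of size \<open>n\<close> consists of the indices \<open>1, \<dots>, n\<close>; index 0 is never used.\<close>

definition emp_joint_df ::
  "(nat \<Rightarrow> 'a \<Rightarrow> real ^ 'p) \<Rightarrow> (nat \<Rightarrow> 'a \<Rightarrow> real) \<Rightarrow> nat \<Rightarrow> 'a \<Rightarrow> real ^ 'p \<Rightarrow> real \<Rightarrow> real" where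
  "emp_joint_df Xs Ys n \<omega> x y =
     (1 / real n) * (\<Sum>i=1..n. of_bool (Xs i \<omega> \<le> x \<and> Ys i \<omega> \<le> y))"

definition emp_marginal_df ::
  "(nat \<Rightarrow> 'a \<Rightarrow> real ^ 'p) \<Rightarrow> nat \<Rightarrow> 'a \<Rightarrow> real ^ 'p \<Rightarrow> real" where
  "emp_marginal_df Xs n \<omega> x = (1 / real n) * (\<Sum>i=1..n. of_bool (Xs i \<omega> \<le> x))"

definition emp_cond_df ::
  "(nat \<Rightarrow> 'a \<Rightarrow> real ^ 'p) \<Rightarrow> (nat \<Rightarrow> 'a \<Rightarrow> real) \<Rightarrow> nat \<Rightarrow> 'a \<Rightarrow> real ^ 'p \<Rightarrow> real \<Rightarrow> real" where
  "emp_cond_df Xs Ys n \<omega> x y = emp_joint_df Xs Ys n \<omega> x y / emp_marginal_df Xs n \<omega> x"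

text \<open>If no \<open>Xs i \<omega>\<close> with \<open>1 \<le> i \<le> n\<close> lies below \<open>x\<close>, the value is an irrelevant constant
  (division by zero); when \<open>x\<close> has positive marginal distribution function, the probability of
  this event tends to 0.\<close>

definition emp_quantile_frontier ::
  "(nat \<Rightarrow> 'a \<Rightarrow> real ^ 'p) \<Rightarrow> (nat \<Rightarrow> 'a \<Rightarrow> real) \<Rightarrow> nat \<Rightarrow> real \<Rightarrow> real ^ 'p \<Rightarrow> 'a \<Rightarrow> real" where
  "emp_quantile_frontier Xs Ys n \<alpha> x \<omega> = Inf {y. 0 \<le> y \<and> \<alpha> \<le> emp_cond_df Xs Ys n \<omega> x y}"

definition distribution_function :: "(real \<Rightarrow> real) \<Rightarrow> bool" where
  "distribution_function G \<longleftrightarrow> (\<exists>D. real_distribution D \<and> G = cdf D)"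

definition non_degenerate :: "(real \<Rightarrow> real) \<Rightarrow> bool" where
  "non_degenerate G \<longleftrightarrow> \<not> (\<exists>c. \<forall>y. G y = (if c \<le> y then 1 else 0))"

definition converges_in_distribution ::
  "'a measure \<Rightarrow> (nat \<Rightarrow> 'a \<Rightarrow> real) \<Rightarrow> (real \<Rightarrow> real) \<Rightarrow> bool" where
  "converges_in_distribution M T G \<longleftrightarrow>
     (\<forall>n. T n \<in> borel_measurable M) \<and> distribution_function G \<and>
     weak_conv (\<lambda>n. cdf (distr M borel (T n))) G"

definition distr_support :: "'a measure \<Rightarrow> ('a \<Rightarrow> real) \<Rightarrow> real set" where
  "distr_support M Y =
     {y. \<forall>U. open U \<and> y \<in> U \<longrightarrow> measure M {\<omega> \<in> space M. Y \<omega> \<in> U} > 0}"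

definition poisson_limit_df :: "nat \<Rightarrow> (real \<Rightarrow> real) \<Rightarrow> real \<Rightarrow> real" where
  "poisson_limit_df k G y =
     (if G y = 0 then 0 else G y * (\<Sum>i=0..k. (- ln (G y)) ^ i / fact i))"

end

theory Submission
  imports Defs "HOL-Real_Asymp.Real_Asymp"
begin

text \<open>Let \<open>N\<close> be the number of sample points with \<open>X\<^sub>i \<le> x\<close> and let \<open>E(y)\<close> count those among them with
\<open>Y\<^sub>i > y\<close>. As \<open>n \<cdot> F\<^sub>n\<^sub>,\<^sub>X(x) = N\<close>, the estimator of level \<open>\<alpha>\<close> is at most \<open>y\<close> exactly when \<open>y \<ge> 0\<close> and
\<open>E(y) \<le> (1 - \<alpha>) N\<close> (\<open>emp_quantile_frontier_le_iff\<close>). At level \<open>1 - k/N\<close> this reads \<open>E(y) \<le> k\<close>: for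
\<open>N > k\<close> the estimator is the \<open>(k+1)\<close>-st largest \<open>Y\<^sub>i\<close> among the points below \<open>x\<close>. The event \<open>N = 0\<close>, on which the
estimators are arbitrary, has the vanishing probability \<open>(1 - F\<^sub>X(x))\<^sup>n\<close>.

For \<open>y \<ge> 0\<close> the count \<open>E(y)\<close> is binomial with parameters \<open>n\<close> and \<open>q(y) = P(X \<le> x, Y > y)\<close>; put \<open>q(y) = 1\<close>
for \<open>y < 0\<close>. Let \<open>t\<close> be a continuity point of \<open>G\<close> and \<open>y\<^sub>n = \<phi>(x) + b\<^sub>n t\<close>. Up to the negligible event, the
hypothesis says \<open>(1 - q(y\<^sub>n))\<^sup>n \<longlonglongrightarrow> G(t)\<close>, that is \<open>n q(y\<^sub>n) \<longlonglongrightarrow> - log G(t)\<close>, with limit \<open>\<infinity>\<close> when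
\<open>G(t) = 0\<close>. By the law of rare events the estimator of level \<open>1 - k/N\<close> is at most \<open>y\<^sub>n\<close> with a
probability that tends to \<open>P(Z \<le> k)\<close>, where \<open>Z\<close> is Poisson of mean \<open>- log G(t)\<close>; this limit is \<open>H(t)\<close>,
and it is 0 when the mean is infinite
(\<open>binomial_cdf_tendsto_poisson_transform\<close>, \<open>order_quantile_df_tendsto\<close>). So \<open>H\<close> is the composition of
\<open>G\<close> with a fixed increasing homeomorphism of \<open>[0,1]\<close>. Hence \<open>H\<close> is a distribution function, and each of
its continuity points is a continuity point of \<open>G\<close>, where the hypothesis may be used
(\<open>isCont_poisson_limit_dfD\<close>). This is part (i).

For part (ii), \<open>b\<^sub>n < 1\<close> eventually (\<open>scale_eventually_less_1\<close>): the FDH estimator converges to \<open>\<phi>(x)\<close>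
unscaled, so a scale that does not shrink would force the limit to be the point mass at 0. Hence
\<open>n (1 - \<alpha>\<^sub>n) = b\<^sub>n \<cdot> (n / b\<^sub>n \<cdot> (1 - \<alpha>\<^sub>n)) < 1\<close> eventually. Then \<open>E(y) \<le> (1 - \<alpha>\<^sub>n) N\<close> means
\<open>E(y) = 0\<close>, and the estimator of level \<open>\<alpha>\<^sub>n\<close> coincides with the FDH estimator.\<close>

section \<open>The Poisson distribution function as a map of the unit interval\<close>

text \<open>For \<open>0 < g \<le> 1\<close> this is \<open>P(Z \<le> k)\<close> for a Poisson variable \<open>Z\<close> of mean \<open>- ln g\<close>; the value at 0 is the
limit for infinite mean.\<close>
definition poisson_transform :: "nat \<Rightarrow> real \<Rightarrow> real" where
  "poisson_transform k g = (if g = 0 then 0 else g * (\<Sum>i=0..k. (- ln g) ^ i / fact i))"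

lemma poisson_limit_df_eq_transform:
  "poisson_limit_df k G = (\<lambda>y. poisson_transform k (G y))"
  by (simp add: poisson_limit_df_def poisson_transform_def fun_eq_iff)

lemma tendsto_neg_ln_at_right_0: "filterlim (\<lambda>g::real. - ln g) at_top (at_right 0)"
  by (simp add: filterlim_uminus_at_bot[symmetric] ln_at_0 filterlim_uminus_at_top)

lemma tendsto_mult_ln_power_at_right_0: "((\<lambda>g::real. g * (- ln g) ^ i) \<longlongrightarrow> 0) (at_right 0)"
proof (rule Lim_transform_eventually)
  show "((\<lambda>g::real. (- ln g) ^ i / exp (- ln g)) \<longlongrightarrow> 0) (at_right 0)"
    by (rule filterlim_compose[OF tendsto_power_div_exp_0 tendsto_neg_ln_at_right_0])
  show "\<forall>\<^sub>F g::real in at_right 0. (- ln g) ^ i / exp (- ln g) = g * (- ln g) ^ i"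
    using eventually_at_right_less[of "0::real"]
    by eventually_elim (simp add: exp_minus field_simps)
qed

text \<open>The sum telescopes: the derivatives of consecutive terms cancel except for the last one. The
derivative that remains is positive on \<open>(0,1)\<close>, which makes the map strictly increasing there.\<close>
lemma poisson_transform_deriv:
  assumes "g > 0"
  shows "(poisson_transform k has_real_derivative (- ln g) ^ k / fact k) (at g)"
proof -
  have "((\<lambda>g. g * (\<Sum>i=0..k. (- ln g) ^ i / fact i)) has_real_derivative (- ln g) ^ k / fact k) (at g)"
  proof (induction k)
    case 0
    show ?case by simp
  next
    case (Suc k)
    have "((\<lambda>g. (- ln g) ^ Suc k) has_real_derivative real (Suc k) * (- (1 / g) * (- ln g) ^ k)) (at g)"
      unfolding of_nat_Suc using assms
      by (intro DERIV_power_Suc DERIV_minus DERIV_ln_divide)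
    then have "((\<lambda>g. g * ((- ln g) ^ Suc k / fact (Suc k))) has_real_derivative
        1 * ((- ln g) ^ Suc k / fact (Suc k))
        + (real (Suc k) * (- (1 / g) * (- ln g) ^ k) / fact (Suc k)) * g) (at g)"
      by (intro DERIV_mult DERIV_ident DERIV_cdivide)
    moreover have "(real (Suc k) * (- (1 / g) * (- ln g) ^ k) / fact (Suc k)) * g = - ((- ln g) ^ k / fact k)"
      using assms by (simp add: divide_simps del: of_nat_Suc)
    ultimately have "((\<lambda>g. g * ((- ln g) ^ Suc k / fact (Suc k))) has_real_derivative
        (- ln g) ^ Suc k / fact (Suc k) - (- ln g) ^ k / fact k) (at g)"
      by (simp del: fact_Suc power_Suc)
    from DERIV_add[OF Suc this] show ?case by (simp add: ring_distribs del: fact_Suc power_Suc)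
  qed
  then show ?thesis
  proof (rule DERIV_cong_ev[THEN iffD1, rotated -1])
    show "\<forall>\<^sub>F g in nhds g. g * (\<Sum>i=0..k. (- ln g) ^ i / fact i) = poisson_transform k g"
      using eventually_nhds_in_open[of "{0<..}" g] assms
      by (auto elim!: eventually_mono simp: poisson_transform_def)
  qed auto
qed

lemma poisson_transform_continuous_on: "continuous_on {0..} (poisson_transform k)"
  unfolding continuous_on_eq_continuous_within
proof
  fix g :: real assume "g \<in> {0..}"
  show "continuous (at g within {0..}) (poisson_transform k)"
  proof (cases "g = 0")
    case True
    have "((\<lambda>g. \<Sum>i=0..k. g * (- ln g) ^ i / fact i) \<longlongrightarrow> (\<Sum>i=0..k. 0 / fact i)) (at_right (0::real))"
      by (intro tendsto_sum tendsto_divide tendsto_mult_ln_power_at_right_0 tendsto_const) auto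
    then have "((\<lambda>g. \<Sum>i=0..k. g * (- ln g) ^ i / fact i) \<longlongrightarrow> 0) (at_right (0::real))" by simp
    then have "(poisson_transform k \<longlongrightarrow> 0) (at_right 0)"
    proof (rule Lim_transform_eventually)
      show "\<forall>\<^sub>F g in at_right 0. (\<Sum>i=0..k. g * (- ln g) ^ i / fact i) = poisson_transform k g"
        using eventually_at_right_less[of "0::real"]
        by eventually_elim (simp add: poisson_transform_def sum_distrib_left)
    qed
    moreover have "at (0::real) within {0..} = at_right 0"
      by (simp add: at_within_def atLeast_def greaterThan_def) (rule arg_cong[where f="\<lambda>S. inf (nhds 0) (principal S)"], auto)
    ultimately show ?thesis
      using True by (simp add: continuous_within poisson_transform_def)
  next
    case False
    with \<open>g \<in> {0..}\<close> have "g > 0" by simp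
    from DERIV_isCont[OF poisson_transform_deriv[OF this]]
    show ?thesis by (rule continuous_at_imp_continuous_at_within)
  qed
qed

lemma poisson_transform_strict_mono:
  assumes "0 \<le> g" "g < h" "h \<le> 1"
  shows "poisson_transform k g < poisson_transform k h"
proof (rule DERIV_pos_imp_increasing_open[OF \<open>g < h\<close>])
  fix z assume "g < z" "z < h"
  with assms show "\<exists>y. (poisson_transform k has_real_derivative y) (at z) \<and> 0 < y"
    by (intro exI[of _ "(- ln z) ^ k / fact k"]) (auto intro!: poisson_transform_deriv)
next
  show "continuous_on {g..h} (poisson_transform k)"
    using assms by (intro continuous_on_subset[OF poisson_transform_continuous_on]) auto
qed

lemma poisson_transform_0 [simp]: "poisson_transform k 0 = 0"
  and poisson_transform_1 [simp]: "poisson_transform k 1 = 1"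
proof -
  show "poisson_transform k 0 = 0" by (simp add: poisson_transform_def)
  have "(\<Sum>i=0..k. 0 ^ i / fact i) = (1::real)"
    by (induction k) auto
  then show "poisson_transform k 1 = 1" by (simp add: poisson_transform_def)
qed

section \<open>The law of rare events\<close>

lemma binomial_over_power_tendsto:
  "(\<lambda>n. real (n choose i) / real n ^ i) \<longlonglongrightarrow> 1 / fact i"
proof -
  have "(\<lambda>n. (\<Prod>j=0..<i. (real n - real j) / real n) / fact i) \<longlonglongrightarrow> (\<Prod>j=0..<i. 1::real) / fact i"
  proof (intro tendsto_divide tendsto_prod tendsto_const)
    fix j
    show "(\<lambda>n. (real n - real j) / real n) \<longlonglongrightarrow> 1"
      by real_asymp
  qed auto
  moreover have "(\<Prod>j=0..<i. (real n - real j) / real n) / fact i = real (n choose i) / real n ^ i" for n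
    by (simp add: binomial_gbinomial gbinomial_prod_rev prod_dividef)
  ultimately show ?thesis by simp
qed

text \<open>Infinite mean: \<open>(1 - q\<^sub>n)\<^sup>n \<longlonglongrightarrow> 0\<close> forces \<open>n q\<^sub>n \<longlonglongrightarrow> \<infinity>\<close>, and the term is at most
\<open>e\<^sup>i (n q\<^sub>n)\<^sup>i / exp (n q\<^sub>n)\<close>. Since \<open>q\<^sub>n\<close> need not tend to 0, the limits of
the separate factors used for finite mean are not available.\<close>
lemma binomial_term_tendsto_0:
  assumes q: "\<And>n. 0 \<le> q n" "\<And>n. q n \<le> 1"
    and lim: "(\<lambda>n. (1 - q n) ^ n) \<longlonglongrightarrow> 0"
  shows "(\<lambda>n. real (n choose i) * q n ^ i * (1 - q n) ^ (n - i)) \<longlonglongrightarrow> 0"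
proof -
  have inf: "filterlim (\<lambda>n. real n * q n) at_top sequentially"
    unfolding filterlim_at_top_gt[where c=0]
  proof safe
    fix K :: real assume "0 < K"
    have "\<forall>\<^sub>F n in sequentially. (1 - q n) ^ n < exp (- (2 * K))"
      using order_tendstoD(2)[OF lim, of "exp (- (2 * K))"] by simp
    moreover have "\<forall>\<^sub>F n in sequentially. real n \<ge> 2 * K" "\<forall>\<^sub>F n in sequentially. n \<ge> 1"
      by real_asymp+
    ultimately show "\<forall>\<^sub>F n in sequentially. K \<le> real n * q n"
    proof eventually_elim
      case (elim n)
      show ?case
      proof (rule ccontr)
        assume "\<not> K \<le> real n * q n"
        then have nq: "real n * q n < K" by simp
        also have "K \<le> real n * (1/2)" using elim by simp
        finally have half: "q n < 1/2" using elim by simp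
        \<comment> \<open>below \<open>1/2\<close> the bound \<open>1 - q \<ge> exp (- 2 q)\<close> holds; this is where the factor 2 comes from\<close>
        have "- 2 * q n \<le> - q n - 2 * (q n)\<^sup>2"
          using half q(1)[of n] mult_mono[of "q n" "1/2" "q n" "q n"] by (simp add: power2_eq_square)
        also have "\<dots> \<le> ln (1 - q n)"
          using half q(1)[of n] by (intro ln_one_minus_pos_lower_bound) auto
        finally have "exp (- 2 * q n) \<le> exp (ln (1 - q n))" by simp
        also have "\<dots> = 1 - q n" using half by simp
        finally have "exp (- 2 * q n) ^ n \<le> (1 - q n) ^ n" by (intro power_mono) auto
        also have "exp (- 2 * q n) ^ n = exp (- (2 * (real n * q n)))"
          by (simp add: exp_of_nat_mult[symmetric] mult_ac)
        finally have "exp (- (2 * (real n * q n))) < exp (- (2 * K))" using elim(1) by linarith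
        then show False using nq by simp
      qed
    qed
  qed
  have bound: "real (n choose i) * q n ^ i * (1 - q n) ^ (n - i) \<le> exp (real i) * ((real n * q n) ^ i / exp (real n * q n))"
    if "n \<ge> i" for n
  proof -
    have "real (n choose i) \<le> real n ^ i"
      by (metis binomial_le_pow[OF that] of_nat_le_iff of_nat_power)
    moreover have "(1 - q n) ^ (n - i) \<le> exp (- q n) ^ (n - i)"
      using q(2)[of n] exp_ge_add_one_self[of "- q n"] by (intro power_mono) auto
    moreover have "exp (- q n) ^ (n - i) = exp (real i * q n - real n * q n)"
      using that by (simp add: exp_of_nat_mult[symmetric] of_nat_diff algebra_simps)
    moreover have "exp (real i * q n - real n * q n) \<le> exp (real i - real n * q n)"
      using q(2)[of n] by (simp add: mult_left_le)
    ultimately have "real (n choose i) \<le> real n ^ i" "(1 - q n) ^ (n - i) \<le> exp (real i - real n * q n)"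
      by linarith+
    then have "(real (n choose i) * q n ^ i) * (1 - q n) ^ (n - i) \<le> (real n ^ i * q n ^ i) * exp (real i - real n * q n)"
      using q[of n] by (intro mult_mono) auto
    then show ?thesis by (simp add: power_mult_distrib exp_diff mult_ac)
  qed
  have "(\<lambda>n. exp (real i) * ((real n * q n) ^ i / exp (real n * q n))) \<longlonglongrightarrow> exp (real i) * 0"
    by (intro tendsto_mult tendsto_const filterlim_compose[OF tendsto_power_div_exp_0 inf])
  then have upper: "(\<lambda>n. exp (real i) * ((real n * q n) ^ i / exp (real n * q n))) \<longlonglongrightarrow> 0" by simp
  show ?thesis
  proof (rule tendsto_sandwich[OF _ _ tendsto_const upper])
    show "\<forall>\<^sub>F n in sequentially. 0 \<le> real (n choose i) * q n ^ i * (1 - q n) ^ (n - i)"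
      using q by (intro always_eventually) auto
    show "\<forall>\<^sub>F n in sequentially. real (n choose i) * q n ^ i * (1 - q n) ^ (n - i)
        \<le> exp (real i) * ((real n * q n) ^ i / exp (real n * q n))"
      by (rule eventually_sequentiallyI[of i], rule bound)
  qed
qed

text \<open>Writing \<open>q\<^sub>n = 1 - exp (- L\<^sub>n / n)\<close> with \<open>L\<^sub>n \<longlonglongrightarrow> - ln g\<close>, the bounds
\<open>u exp (- u) \<le> 1 - exp (- u) \<le> u\<close> at \<open>u = L\<^sub>n / n\<close> enclose \<open>n q\<^sub>n\<close>.\<close>
lemma rate_tendsto_neg_ln:
  assumes lim: "(\<lambda>n. (1 - q n) ^ n) \<longlonglongrightarrow> g" and q: "\<And>n. q n \<le> 1" and g: "g > (0::real)"
  shows "(\<lambda>n. real n * q n) \<longlonglongrightarrow> - ln g"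
proof -
  define L where "L n = - ln ((1 - q n) ^ n)" for n
  have L: "L \<longlonglongrightarrow> - ln g"
    unfolding L_def using lim g by (intro tendsto_intros) auto
  have "(\<lambda>n. L n * exp (- (L n * (1 / real n)))) \<longlonglongrightarrow> - ln g * exp (- (- ln g * 0))"
    by (intro tendsto_intros L lim_1_over_n)
  then have lower: "(\<lambda>n. L n * exp (- (L n / real n))) \<longlonglongrightarrow> - ln g" by simp
  have ev: "\<forall>\<^sub>F n in sequentially. n \<ge> 1 \<and> (1 - q n) ^ n > 0"
    using order_tendstoD(1)[OF lim g] eventually_ge_at_top[of 1] by (auto intro: eventually_conj)
  have *: "q n = 1 - exp (- (L n / real n))" if "n \<ge> 1 \<and> (1 - q n) ^ n > 0" for n
  proof -
    from that q[of n] have "1 - q n > 0"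
      by (metis diff_ge_0_iff_ge less_irrefl not_one_le_zero order_le_less zero_power not_gr_zero)
    then show ?thesis using that by (simp add: L_def ln_realpow)
  qed
  show ?thesis
  proof (rule tendsto_sandwich[OF _ _ lower L])
    show "\<forall>\<^sub>F n in sequentially. L n * exp (- (L n / real n)) \<le> real n * q n"
      using ev
    proof eventually_elim
      case (elim n)
      let ?u = "L n / real n"
      have "(1 + ?u) * exp (- ?u) \<le> exp ?u * exp (- ?u)"
        by (intro mult_right_mono exp_ge_add_one_self) auto
      then have "?u * exp (- ?u) \<le> 1 - exp (- ?u)"
        by (simp add: exp_minus ring_distribs field_simps)
      then have "real n * (?u * exp (- ?u)) \<le> real n * (1 - exp (- ?u))"
        by (intro mult_left_mono) auto
      then show ?case using elim by (subst *[OF elim]) simp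
    qed
    show "\<forall>\<^sub>F n in sequentially. real n * q n \<le> L n"
      using ev
    proof eventually_elim
      case (elim n)
      let ?u = "L n / real n"
      have "real n * (1 - exp (- ?u)) \<le> real n * ?u"
        using exp_ge_add_one_self[of "- ?u"] by (intro mult_left_mono) auto
      then show ?case using elim by (subst *[OF elim]) simp
    qed
  qed
qed

lemma binomial_term_tendsto_poisson:
  assumes lim: "(\<lambda>n. (1 - q n) ^ n) \<longlonglongrightarrow> g" and q: "\<And>n. q n \<le> 1" and g: "g > (0::real)"
  shows "(\<lambda>n. real (n choose i) * q n ^ i * (1 - q n) ^ (n - i)) \<longlonglongrightarrow> g * ((- ln g) ^ i / fact i)"
proof -
  note rate = rate_tendsto_neg_ln[OF assms]
  have "(\<lambda>n. (real n * q n) * (1 / real n)) \<longlonglongrightarrow> - ln g * 0"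
    by (intro tendsto_intros rate lim_1_over_n)
  then have "(\<lambda>n. (real n * q n) * (1 / real n)) \<longlonglongrightarrow> 0" by simp
  then have q0: "q \<longlonglongrightarrow> 0"
    by (rule Lim_transform_eventually, use eventually_ge_at_top[of 1] in eventually_elim) simp
  have "(\<lambda>n. (real (n choose i) / real n ^ i) * (real n * q n) ^ i * ((1 - q n) ^ n / (1 - q n) ^ i))
      \<longlonglongrightarrow> (1 / fact i) * (- ln g) ^ i * (g / (1 - 0) ^ i)"
    by (intro tendsto_intros binomial_over_power_tendsto rate lim q0) auto
  then have "(\<lambda>n. (real (n choose i) / real n ^ i) * (real n * q n) ^ i * ((1 - q n) ^ n / (1 - q n) ^ i))
      \<longlonglongrightarrow> g * ((- ln g) ^ i / fact i)" by (simp add: mult.commute)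
  then show ?thesis
  proof (rule Lim_transform_eventually)
    have "\<forall>\<^sub>F n in sequentially. q n < 1"
      using order_tendstoD(2)[OF q0, of 1] by simp
    with eventually_ge_at_top[of "max 1 i"]
    show "\<forall>\<^sub>F n in sequentially. (real (n choose i) / real n ^ i) * (real n * q n) ^ i * ((1 - q n) ^ n / (1 - q n) ^ i)
        = real (n choose i) * q n ^ i * (1 - q n) ^ (n - i)"
    proof eventually_elim
      case (elim n)
      then have "(1 - q n) ^ n / (1 - q n) ^ i = (1 - q n) ^ (n - i)"
        by (simp add: power_diff)
      with elim show ?case by (simp add: power_mult_distrib)
    qed
  qed
qed

lemma binomial_cdf_tendsto_poisson_transform:
  assumes q: "\<And>n. 0 \<le> q n" "\<And>n. q n \<le> 1"
    and lim: "(\<lambda>n. (1 - q n) ^ n) \<longlonglongrightarrow> g" 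
  shows "(\<lambda>n. \<Sum>i=0..k. real (n choose i) * q n ^ i * (1 - q n) ^ (n - i)) \<longlonglongrightarrow> poisson_transform k g"
proof (cases "g = 0")
  case True
  then have "(\<lambda>n. \<Sum>i=0..k. real (n choose i) * q n ^ i * (1 - q n) ^ (n - i)) \<longlonglongrightarrow> (\<Sum>i=0..k. 0)"
    using q lim by (intro tendsto_sum binomial_term_tendsto_0) auto
  with True show ?thesis by simp
next
  case False
  have "g \<ge> 0" using q by (intro LIMSEQ_le_const[OF lim]) auto
  with False have "g > 0" by simp
  then have "(\<lambda>n. \<Sum>i=0..k. real (n choose i) * q n ^ i * (1 - q n) ^ (n - i)) \<longlonglongrightarrow> (\<Sum>i=0..k. g * ((- ln g) ^ i / fact i))"
    using q lim by (intro tendsto_sum binomial_term_tendsto_poisson) auto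
  with False show ?thesis by (simp add: poisson_transform_def sum_distrib_left)
qed

section \<open>The limiting distribution function\<close>

lemma distribution_functionD:
  assumes "distribution_function G"
  shows "mono G" "0 \<le> G t" "G t \<le> 1" "continuous (at_right t) G" "(G \<longlongrightarrow> 0) at_bot" "(G \<longlongrightarrow> 1) at_top"
proof -
  obtain D where "real_distribution D" and G: "G = cdf D"
    using assms by (auto simp: distribution_function_def)
  then interpret real_distribution D by simp
  show "mono G" "0 \<le> G t" "G t \<le> 1" "continuous (at_right t) G" "(G \<longlongrightarrow> 0) at_bot" "(G \<longlongrightarrow> 1) at_top"
    by (auto simp: G intro: monoI cdf_nondecreasing cdf_nonneg cdf_bounded_prob
        cdf_is_right_cont cdf_lim_at_bot cdf_lim_at_top_prob)
qed

lemma poisson_transform_tendsto: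
  assumes "(f \<longlongrightarrow> c) F" "\<And>t. 0 \<le> f t" "0 \<le> c"
  shows "((\<lambda>t. poisson_transform k (f t)) \<longlongrightarrow> poisson_transform k c) F"
  using assms by (intro continuous_on_tendsto_compose[OF poisson_transform_continuous_on]) auto

lemma distribution_function_poisson_limit_df:
  assumes "distribution_function G"
  shows "distribution_function (poisson_limit_df k G)"
proof -
  note G = distribution_functionD[OF assms]
  let ?H = "poisson_limit_df k G"
  have mono: "?H s \<le> ?H t" if "s \<le> t" for s t
    using poisson_transform_strict_mono[of "G s" "G t" k] G(2)[of s] G(3)[of t] monoD[OF G(1) that]
    by (cases "G s = G t") (auto simp: poisson_limit_df_eq_transform)
  have right: "continuous (at_right t) ?H" for t
    using poisson_transform_tendsto[of G "G t" "at_right t" k] G(2,4)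
    by (simp add: poisson_limit_df_eq_transform continuous_within)
  have bot: "(?H \<longlongrightarrow> 0) at_bot"
    using poisson_transform_tendsto[OF G(5), of k] G(2) by (simp add: poisson_limit_df_eq_transform)
  have top: "(?H \<longlongrightarrow> 1) at_top"
    using poisson_transform_tendsto[OF G(6), of k] G(2) by (simp add: poisson_limit_df_eq_transform)
  show ?thesis
    unfolding distribution_function_def
    using real_distribution_interval_measure[OF mono right bot top] cdf_interval_measure[OF mono right bot]
    by metis
qed

text \<open>The transform is a homeomorphism of \<open>[0,1]\<close> onto its image, so \<open>G\<close> is recovered from \<open>H\<close> by applying
a continuous inverse. Thus weak convergence to \<open>H\<close> only has to be tested where the convergence to \<open>G\<close> is known.\<close>
lemma isCont_poisson_limit_dfD:
  assumes "distribution_function G" and cont: "isCont (poisson_limit_df k G) t"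
  shows "isCont G t"
proof -
  note G = distribution_functionD[OF assms(1)]
  let ?h = "poisson_transform k"
  let ?h' = "inv_into {0..1} ?h"
  have inj: "inj_on ?h {0..1}"
    by (rule linorder_inj_onI) (use poisson_transform_strict_mono[of _ _ k] in fastforce)+
  have cont': "continuous_on (?h ` {0..1}) ?h'"
    using inj by (intro continuous_on_inv continuous_on_subset[OF poisson_transform_continuous_on]) auto
  have inv: "?h' (?h (G s)) = G s" for s
    using inv_into_f_f[OF inj, of "G s"] G(2,3) by simp
  have "((\<lambda>s. ?h (G s)) \<longlongrightarrow> ?h (G t)) (at t)"
    using cont by (simp add: isCont_def poisson_limit_df_eq_transform)
  from continuous_on_tendsto_compose[OF cont' this]
  have "((\<lambda>s. ?h' (?h (G s))) \<longlongrightarrow> ?h' (?h (G t))) (at t)"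
    using G(2,3) by simp
  then show ?thesis by (simp add: inv isCont_def)
qed

lemma mono_isCont_between:
  fixes f :: "real \<Rightarrow> real"
  assumes "mono f" "a < b"
  obtains c where "a < c" "c < b" "isCont f c"
proof -
  have "uncountable ({a<..<b} - {c. \<not> isCont f c})"
    using assms by (intro uncountable_minus_countable uncountable_open_interval[THEN iffD2] mono_ctble_discont)
  then have "{a<..<b} - {c. \<not> isCont f c} \<noteq> {}" by (metis countable_empty)
  with that show ?thesis by auto
qed

text \<open>Monotonicity and right continuity determine \<open>G\<close> by its continuity points. If at all of them other
than 0 it had the values of the point mass at 0, it would be degenerate.\<close>
lemma non_degenerate_continuity_point:
  assumes G: "distribution_function G" "non_degenerate G"
  shows "\<exists>t. isCont G t \<and> (t > 0 \<and> G t \<noteq> 1 \<or> t < 0 \<and> G t \<noteq> 0)"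
proof (rule ccontr)
  assume "\<not> ?thesis"
  then have one: "\<And>t. isCont G t \<Longrightarrow> t > 0 \<Longrightarrow> G t = 1"
    and zero: "\<And>t. isCont G t \<Longrightarrow> t < 0 \<Longrightarrow> G t = 0" by auto
  note D = distribution_functionD[OF G(1)]
  have pos: "G y = 1" if y: "0 < y" for y
  proof -
    obtain c where "0 < c" "c < y" "isCont G c" using mono_isCont_between[OF D(1) y] .
    with one[of c] monoD[OF D(1), of c y] D(3)[of y] show ?thesis by simp
  qed
  have neg: "G y = 0" if y: "y < 0" for y
  proof -
    obtain c where "y < c" "c < 0" "isCont G c" using mono_isCont_between[OF D(1) y] .
    with zero[of c] monoD[OF D(1), of y c] D(2)[of y] show ?thesis by simp
  qed
  have "(G \<longlongrightarrow> 1) (at_right 0)"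
    by (rule Lim_transform_eventually[OF tendsto_const], use eventually_at_right_less[of "0::real"] in eventually_elim)
       (simp add: pos)
  then have "G 0 = 1"
    using D(4)[of 0] tendsto_unique[of "at_right (0::real)" G] by (auto simp: continuous_within)
  with pos neg have "\<forall>y. G y = (if 0 \<le> y then 1 else 0)" by (metis not_le order_le_less)
  with G(2) show False unfolding non_degenerate_def by blast
qed

section \<open>Empirical quantiles in terms of counts\<close>

definition num_below :: "(nat \<Rightarrow> 'a \<Rightarrow> real ^ 'p) \<Rightarrow> nat \<Rightarrow> real ^ 'p \<Rightarrow> 'a \<Rightarrow> nat" where
  "num_below Xs n x \<omega> = card {i \<in> {1..n}. Xs i \<omega> \<le> x}"

definition num_exceed ::
  "(nat \<Rightarrow> 'a \<Rightarrow> real ^ 'p) \<Rightarrow> (nat \<Rightarrow> 'a \<Rightarrow> real) \<Rightarrow> nat \<Rightarrow> real ^ 'p \<Rightarrow> real \<Rightarrow> 'a \<Rightarrow> nat" where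
  "num_exceed Xs Ys n x y \<omega> = card {i \<in> {1..n}. Xs i \<omega> \<le> x \<and> y < Ys i \<omega>}"

lemma num_below_le: "num_below Xs n x \<omega> \<le> n"
  unfolding num_below_def by (rule order_trans[OF card_mono[of "{1..n}"]]) auto

lemma size_times_emp_marginal_df: "real n * emp_marginal_df Xs n \<omega> x = real (num_below Xs n x \<omega>)"
  by (simp add: emp_marginal_df_def num_below_def sum_of_bool_eq Int_def)

lemma emp_cond_df_eq_counts:
  "emp_cond_df Xs Ys n \<omega> x y =
     (real (num_below Xs n x \<omega>) - real (num_exceed Xs Ys n x y \<omega>)) / real (num_below Xs n x \<omega>)"
proof (cases "n = 0")
  case True
  then show ?thesis by (simp add: emp_cond_df_def emp_joint_df_def num_below_def num_exceed_def)
next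
  case False
  have "{i \<in> {1..n}. Xs i \<omega> \<le> x} = {i \<in> {1..n}. Xs i \<omega> \<le> x \<and> Ys i \<omega> \<le> y} \<union> {i \<in> {1..n}. Xs i \<omega> \<le> x \<and> y < Ys i \<omega>}"
    by auto
  then have "num_below Xs n x \<omega> = card {i \<in> {1..n}. Xs i \<omega> \<le> x \<and> Ys i \<omega> \<le> y} + num_exceed Xs Ys n x y \<omega>"
    unfolding num_below_def num_exceed_def by (subst card_Un_disjoint[symmetric]) auto
  with False show ?thesis
    by (simp add: emp_cond_df_def emp_joint_df_def emp_marginal_df_def num_below_def sum_of_bool_eq Int_def)
qed

text \<open>The set whose infimum is the quantile is an up-set of \<open>[0,\<infinity>)\<close>. The infimum belongs to it because the
number of exceedances is a right-continuous step function of the threshold.\<close>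
lemma emp_quantile_frontier_le_iff:
  assumes N: "num_below Xs n x \<omega> > 0" and \<alpha>: "\<alpha> \<le> 1"
  shows "emp_quantile_frontier Xs Ys n \<alpha> x \<omega> \<le> y \<longleftrightarrow>
    0 \<le> y \<and> real (num_exceed Xs Ys n x y \<omega>) \<le> (1 - \<alpha>) * real (num_below Xs n x \<omega>)"
proof -
  let ?E = "\<lambda>y. num_exceed Xs Ys n x y \<omega>" and ?c = "(1 - \<alpha>) * real (num_below Xs n x \<omega>)"
  define S where "S = {y. 0 \<le> y \<and> real (?E y) \<le> ?c}"
  have Inf: "emp_quantile_frontier Xs Ys n \<alpha> x \<omega> = Inf S"
    unfolding emp_quantile_frontier_def emp_cond_df_eq_counts S_def
    using N by (intro arg_cong[where f=Inf]) (auto simp: field_simps)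
  have bdd: "bdd_below S" by (auto simp: S_def intro: bdd_belowI[of _ 0])
  \<comment> \<open>no sample point exceeds \<open>u\<close>, so the set is non-empty\<close>
  define u where "u = Max (insert 0 ((\<lambda>i. Ys i \<omega>) ` {1..n}))"
  have u: "0 \<le> u" "\<And>i. i \<in> {1..n} \<Longrightarrow> Ys i \<omega> \<le> u"
    unfolding u_def by (auto intro!: Max_ge simp del: Max_insert)
  then have "?E u = 0" by (force simp: num_exceed_def)
  with u(1) \<alpha> have "u \<in> S" by (simp add: S_def)
  then have ne: "S \<noteq> {}" by auto
  have "y \<in> S" if le: "Inf S \<le> y"
  proof -
    have "0 \<le> Inf S" by (rule cInf_greatest[OF ne]) (simp add: S_def)
    with le have "0 \<le> y" by simp
    \<comment> \<open>the count is constant on \<open>[y, z)\<close>\<close>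
    define z where "z = Min (insert (y + 1) {Ys i \<omega> |i. i \<in> {1..n} \<and> y < Ys i \<omega>})"
    have fin: "finite {Ys i \<omega> |i. i \<in> {1..n} \<and> y < Ys i \<omega>}" by simp
    have "y < z" using fin unfolding z_def by (subst Min_gr_iff) auto
    with le obtain s where s: "s \<in> S" "s < z" using cInf_lessD[OF ne] by (metis order_le_less_trans)
    have "Ys i \<omega> > s" if "i \<in> {1..n}" "y < Ys i \<omega>" for i
    proof -
      have "z \<le> Ys i \<omega>" unfolding z_def using fin that by (intro Min_le) auto
      with s show ?thesis by simp
    qed
    then have "?E y \<le> ?E s" unfolding num_exceed_def by (intro card_mono) auto
    with s(1) \<open>0 \<le> y\<close> show ?thesis by (simp add: S_def)
  qed
  moreover have "Inf S \<le> y" if "y \<in> S" using that bdd by (rule cInf_lower)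
  ultimately have "Inf S \<le> y \<longleftrightarrow> y \<in> S" by blast
  then show ?thesis unfolding Inf by (simp add: S_def)
qed

lemma emp_quantile_frontier_empty:
  assumes "num_below Xs n x \<omega> = 0" "\<alpha> > 0"
  shows "emp_quantile_frontier Xs Ys n \<alpha> x \<omega> = Inf {}"
  using assms by (simp add: emp_quantile_frontier_def emp_cond_df_eq_counts)

text \<open>As \<open>N \<le> n\<close>, fewer than one exceedance is allowed, that is none, as for the FDH estimator. If no sample
point lies below \<open>x\<close>, both sides are the same default value.\<close>
lemma emp_quantile_frontier_eq_FDH:
  assumes \<alpha>: "0 < \<alpha>" "\<alpha> \<le> 1" and small: "real n * (1 - \<alpha>) < 1"
  shows "emp_quantile_frontier Xs Ys n \<alpha> x \<omega> = emp_quantile_frontier Xs Ys n 1 x \<omega>"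
proof (cases "num_below Xs n x \<omega> = 0")
  case True
  with \<alpha> show ?thesis by (simp add: emp_quantile_frontier_empty)
next
  case False
  have "(1 - \<alpha>) * real (num_below Xs n x \<omega>) \<le> (1 - \<alpha>) * real n"
    by (intro mult_left_mono) (simp_all add: \<alpha> num_below_le)
  with small have "(1 - \<alpha>) * real (num_below Xs n x \<omega>) < 1" by (simp add: mult.commute)
  moreover have "0 \<le> (1 - \<alpha>) * real (num_below Xs n x \<omega>)" using \<alpha> by simp
  ultimately have "real m \<le> (1 - \<alpha>) * real (num_below Xs n x \<omega>) \<longleftrightarrow> m = 0" for m :: nat
    by (cases "m = 0") linarith+
  then have "emp_quantile_frontier Xs Ys n \<alpha> x \<omega> \<le> y \<longleftrightarrow> emp_quantile_frontier Xs Ys n 1 x \<omega> \<le> y" for y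
    using False \<alpha> by (simp add: emp_quantile_frontier_le_iff)
  from this[of "emp_quantile_frontier Xs Ys n 1 x \<omega>"] this[of "emp_quantile_frontier Xs Ys n \<alpha> x \<omega>"]
  show ?thesis by simp
qed

section \<open>Counting independent events\<close>

text \<open>The binomial law, obtained by splitting according to the set \<open>J\<close> of indices at which the event occurs:
by independence each of the \<open>card I choose j\<close> disjoint pieces has the same probability.\<close>
lemma (in prob_space) prob_count_eq:
  fixes Z :: "'i \<Rightarrow> 'a \<Rightarrow> 'b"
  assumes indep: "indep_vars (\<lambda>_. S) Z I" and I: "finite I" and U: "U \<in> sets S"
    and q: "\<And>i. i \<in> I \<Longrightarrow> prob (Z i -` U \<inter> space M) = q"
  shows "prob {\<omega> \<in> space M. card {i \<in> I. Z i \<omega> \<in> U} = j} = real (card I choose j) * q ^ j * (1 - q) ^ (card I - j)"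
proof (cases "I = {}")
  case True
  then show ?thesis by (cases j) (simp_all add: prob_space)
next
  case False
  have Z: "random_variable S (Z i)" if "i \<in> I" for i
    using indep_vars_def[THEN iffD1, OF indep] that by auto
  define A where "A J = {\<omega> \<in> space M. {i \<in> I. Z i \<omega> \<in> U} = J}" for J
  define B where "B J i = (if i \<in> J then U else space S - U)" for J :: "'i set" and i
  have A_eq: "A J = (\<Inter>i\<in>I. Z i -` B J i \<inter> space M)" if "J \<subseteq> I" for J
    using that False measurable_space[OF Z] by (auto simp: A_def B_def split: if_splits)
  have A_sets: "A J \<in> events" if "J \<subseteq> I" for J
    unfolding A_eq[OF that] using False I U
    by (intro sets.finite_INT measurable_sets[OF Z]) (auto simp: B_def)
  have prob_B: "prob (Z i -` B J i \<inter> space M) = (if i \<in> J then q else 1 - q)" if "i \<in> I" for i J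
  proof -
    have "Z i -` (space S - U) \<inter> space M = space M - (Z i -` U \<inter> space M)"
      using measurable_space[OF Z[OF that]] by auto
    then show ?thesis
      using q[OF that] prob_compl[OF measurable_sets[OF Z[OF that] U]] by (simp add: B_def)
  qed
  have prob_A: "prob (A J) = q ^ j * (1 - q) ^ (card I - j)" if J: "J \<subseteq> I" "card J = j" for J
  proof -
    have "prob (A J) = (\<Prod>i\<in>I. prob (Z i -` B J i \<inter> space M))"
      unfolding A_eq[OF J(1)] using False I U by (intro indep_varsD_finite[OF indep]) (auto simp: B_def)
    also have "\<dots> = (\<Prod>i\<in>I. if i \<in> J then q else 1 - q)"
      by (intro prod.cong prob_B) auto
    also have "\<dots> = q ^ j * (1 - q) ^ (card I - j)"
      using J I finite_subset[OF J(1) I] by (simp add: prod.If_cases Int_absorb1 card_Diff_subset Diff_eq[symmetric])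
    finally show ?thesis .
  qed
  have "{\<omega> \<in> space M. card {i \<in> I. Z i \<omega> \<in> U} = j} = (\<Union>J\<in>{J. J \<subseteq> I \<and> card J = j}. A J)"
    by (auto simp: A_def)
  then have "prob {\<omega> \<in> space M. card {i \<in> I. Z i \<omega> \<in> U} = j} = prob (\<Union>J\<in>{J. J \<subseteq> I \<and> card J = j}. A J)"
    by simp
  also have "\<dots> = (\<Sum>J\<in>{J. J \<subseteq> I \<and> card J = j}. prob (A J))"
    using I A_sets by (intro finite_measure_finite_Union) (auto simp: disjoint_family_on_def A_def)
  also have "\<dots> = real (card I choose j) * q ^ j * (1 - q) ^ (card I - j)"
    using prob_A n_subsets[OF I, of j] by simp
  finally show ?thesis .
qed

section \<open>Order statistics of an independent sample below a point\<close>

lemma borel_below: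
  fixes x :: "real ^ 'p"
  shows "{(a, b). a \<le> x} \<in> sets (borel :: ((real ^ 'p) \<times> real) measure)"
proof -
  have "{(a, b). a \<le> x} = {..x} \<times> (UNIV :: real set)" by auto
  then show ?thesis by (auto intro!: borel_closed closed_Times)
qed

lemma borel_exceed:
  fixes x :: "real ^ 'p"
  shows "{(a, b). a \<le> x \<and> y < b} \<in> sets (borel :: ((real ^ 'p) \<times> real) measure)"
proof -
  have "{(a, b). a \<le> x \<and> y < b} = {(a, b). a \<le> x} \<inter> ((UNIV :: (real ^ 'p) set) \<times> {y<..})" by auto
  moreover have "(UNIV :: (real ^ 'p) set) \<times> {y<..} \<in> sets borel"
    by (auto intro!: borel_open open_Times)
  ultimately show ?thesis using borel_below by auto
qed

locale iid_sample = prob_space M for M :: "'a measure" +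
  fixes Xs :: "nat \<Rightarrow> 'a \<Rightarrow> real ^ 'p" and Ys :: "nat \<Rightarrow> 'a \<Rightarrow> real"
    and Q :: "((real ^ 'p) \<times> real) measure" and x :: "real ^ 'p"
  assumes indep: "indep_vars (\<lambda>_. borel) (\<lambda>i \<omega>. (Xs i \<omega>, Ys i \<omega>)) {1..}"
    and law: "i \<ge> 1 \<Longrightarrow> distr M borel (\<lambda>\<omega>. (Xs i \<omega>, Ys i \<omega>)) = Q"
    and below_pos: "measure Q {(a, b). a \<le> x} > 0"
begin

text \<open>For \<open>y < 0\<close> the value is 1 because the estimators are infima of sets of non-negative numbers. With this
convention \<open>(1 - exceed_prob y)\<^sup>n\<close> is, up to the event of an empty sample below \<open>x\<close>, the distribution
function of the FDH estimator at every real \<open>y\<close>, for \<open>n \<ge> 1\<close>.\<close>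
definition exceed_prob :: "real \<Rightarrow> real" where
  "exceed_prob y = (if 0 \<le> y then measure Q {(a, b). a \<le> x \<and> y < b} else 1)"

lemma measurable_pair: "i \<ge> 1 \<Longrightarrow> (\<lambda>\<omega>. (Xs i \<omega>, Ys i \<omega>)) \<in> borel_measurable M"
  using indep by (auto simp: indep_vars_def)

lemma prob_space_Q: "prob_space Q" and sets_Q: "sets Q = sets borel"
  using law[of 1] prob_space_distr[OF measurable_pair[of 1]] by auto

lemma prob_pair_in:
  assumes "i \<ge> 1" "U \<in> sets borel"
  shows "prob ((\<lambda>\<omega>. (Xs i \<omega>, Ys i \<omega>)) -` U \<inter> space M) = measure Q U"
  using measure_distr[OF measurable_pair[OF assms(1)] assms(2)] law[OF assms(1)] by simp

lemma prob_count_pairs_eq: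
  assumes "U \<in> sets borel"
  shows "prob {\<omega> \<in> space M. card {i \<in> {1..n}. (Xs i \<omega>, Ys i \<omega>) \<in> U} = j}
    = real (n choose j) * measure Q U ^ j * (1 - measure Q U) ^ (n - j)"
proof -
  have "indep_vars (\<lambda>_. borel) (\<lambda>i \<omega>. (Xs i \<omega>, Ys i \<omega>)) {1..n}"
    by (rule indep_vars_subset[OF indep]) auto
  from prob_count_eq[OF this _ assms, of "measure Q U" j] show ?thesis
    using prob_pair_in[OF _ assms] by simp
qed

lemma prob_num_below_0: "prob {\<omega> \<in> space M. num_below Xs n x \<omega> = 0} = (1 - measure Q {(a, b). a \<le> x}) ^ n"
  using prob_count_pairs_eq[OF borel_below[of x], of n 0]
  by (simp only: num_below_def mem_Collect_eq prod.case binomial_n_0 of_nat_1 power_0 mult_1 diff_zero)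

lemma measurable_count_pairs:
  assumes "U \<in> sets borel"
  shows "(\<lambda>\<omega>. card {i \<in> {1..n}. (Xs i \<omega>, Ys i \<omega>) \<in> U}) \<in> measurable M (count_space UNIV)"
proof (rule measurable_card)
  fix i
  show "{\<omega> \<in> space M. i \<in> {i \<in> {1..n}. (Xs i \<omega>, Ys i \<omega>) \<in> U}} \<in> events"
  proof (cases "i \<in> {1..n}")
    case True
    then have "(\<lambda>\<omega>. (Xs i \<omega>, Ys i \<omega>)) -` U \<inter> space M \<in> events"
      by (intro measurable_sets[OF measurable_pair] assms) auto
    moreover have "(\<lambda>\<omega>. (Xs i \<omega>, Ys i \<omega>)) -` U \<inter> space M
        = {\<omega> \<in> space M. i \<in> {i \<in> {1..n}. (Xs i \<omega>, Ys i \<omega>) \<in> U}}"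
      using True by auto
    ultimately show ?thesis by (rule back_subst)
  next
    case False
    then have "{\<omega> \<in> space M. i \<in> {i \<in> {1..n}. (Xs i \<omega>, Ys i \<omega>) \<in> U}} = {}" by blast
    then show ?thesis by (simp only: sets.empty_sets)
  qed
qed

lemma measurable_num_below [measurable]: "num_below Xs n x \<in> measurable M (count_space UNIV)"
  using measurable_count_pairs[OF borel_below[of x], of n]
  by (simp only: num_below_def[abs_def] mem_Collect_eq prod.case)

lemma measurable_num_exceed [measurable]: "num_exceed Xs Ys n x y \<in> measurable M (count_space UNIV)"
  using measurable_count_pairs[OF borel_exceed[of x y], of n]
  by (simp only: num_exceed_def[abs_def] mem_Collect_eq prod.case)

lemma prob_num_exceed_le:
  assumes "0 \<le> y"
  shows "prob {\<omega> \<in> space M. num_exceed Xs Ys n x y \<omega> \<le> k}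
    = (\<Sum>i=0..k. real (n choose i) * exceed_prob y ^ i * (1 - exceed_prob y) ^ (n - i))"
proof -
  have "{\<omega> \<in> space M. num_exceed Xs Ys n x y \<omega> \<le> k} = (\<Union>i\<in>{0..k}. {\<omega> \<in> space M. num_exceed Xs Ys n x y \<omega> = i})"
    by auto
  then have "prob {\<omega> \<in> space M. num_exceed Xs Ys n x y \<omega> \<le> k} = prob (\<Union>i\<in>{0..k}. {\<omega> \<in> space M. num_exceed Xs Ys n x y \<omega> = i})"
    by simp
  also have "\<dots> = (\<Sum>i=0..k. prob {\<omega> \<in> space M. num_exceed Xs Ys n x y \<omega> = i})"
    by (intro finite_measure_finite_Union) (auto simp: disjoint_family_on_def)
  also have "\<dots> = (\<Sum>i=0..k. real (n choose i) * exceed_prob y ^ i * (1 - exceed_prob y) ^ (n - i))"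
    using prob_count_pairs_eq[OF borel_exceed[of x y], of n] assms
    by (simp add: num_exceed_def exceed_prob_def)
  finally show ?thesis .
qed

lemma exceed_prob_bounds: "0 \<le> exceed_prob y" "exceed_prob y \<le> 1"
  using prob_space.prob_le_1[OF prob_space_Q] by (auto simp: exceed_prob_def)

lemma exceed_prob_antimono: "y \<le> z \<Longrightarrow> exceed_prob z \<le> exceed_prob y"
proof -
  interpret Q: prob_space Q by (rule prob_space_Q)
  assume "y \<le> z"
  then show ?thesis
    using Q.prob_le_1 borel_exceed[of x y]
    by (auto simp: exceed_prob_def sets_Q intro!: Q.finite_measure_mono)
qed

text \<open>When \<open>k\<close> is less than the number of sample points below \<open>x\<close> and their outputs are non-negative, this is
the \<open>(k+1)\<close>-st largest of these outputs.\<close>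
definition order_quantile :: "nat \<Rightarrow> nat \<Rightarrow> 'a \<Rightarrow> real" where
  "order_quantile k n \<omega> =
     emp_quantile_frontier Xs Ys n (1 - real k / (real n * emp_marginal_df Xs n \<omega> x)) x \<omega>"

lemma order_quantile_le_iff:
  assumes "num_below Xs n x \<omega> > 0"
  shows "order_quantile k n \<omega> \<le> y \<longleftrightarrow> 0 \<le> y \<and> num_exceed Xs Ys n x y \<omega> \<le> k"
  using assms by (simp add: order_quantile_def emp_quantile_frontier_le_iff size_times_emp_marginal_df)

lemma order_quantile_empty: "num_below Xs n x \<omega> = 0 \<Longrightarrow> order_quantile k n \<omega> = Inf {}"
  by (simp add: order_quantile_def emp_quantile_frontier_empty size_times_emp_marginal_df)

lemma measurable_order_quantile [measurable]: "order_quantile k n \<in> borel_measurable M"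
proof (rule borel_measurableI_le)
  fix y
  have le_iff: "order_quantile k n \<omega> \<le> y \<longleftrightarrow>
      (if num_below Xs n x \<omega> = 0 then Inf {} \<le> y else 0 \<le> y \<and> num_exceed Xs Ys n x y \<omega> \<le> k)" for \<omega>
    by (simp add: order_quantile_le_iff order_quantile_empty)
  show "{\<omega> \<in> space M. order_quantile k n \<omega> \<le> y} \<in> events" unfolding le_iff by measurable
qed

lemma measurable_emp_quantile_frontier:
  assumes "0 < \<alpha>" "\<alpha> \<le> 1"
  shows "emp_quantile_frontier Xs Ys n \<alpha> x \<in> borel_measurable M"
proof (rule borel_measurableI_le)
  fix y
  have le_iff: "emp_quantile_frontier Xs Ys n \<alpha> x \<omega> \<le> y \<longleftrightarrow>
      (if num_below Xs n x \<omega> = 0 then Inf {} \<le> y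
       else 0 \<le> y \<and> real (num_exceed Xs Ys n x y \<omega>) \<le> (1 - \<alpha>) * real (num_below Xs n x \<omega>))" for \<omega>
    using assms by (simp add: emp_quantile_frontier_le_iff emp_quantile_frontier_empty)
  have real: "(\<lambda>\<omega>. real (num_exceed Xs Ys n x y \<omega>)) \<in> borel_measurable M"
    "(\<lambda>\<omega>. (1 - \<alpha>) * real (num_below Xs n x \<omega>)) \<in> borel_measurable M"
    by (auto intro: measurable_compose[OF measurable_num_exceed] measurable_compose[OF measurable_num_below])
  have [measurable]: "Measurable.pred M (\<lambda>\<omega>. real (num_exceed Xs Ys n x y \<omega>) \<le> (1 - \<alpha>) * real (num_below Xs n x \<omega>))"
    unfolding pred_def by (rule borel_measurable_le[OF real])
  show "{\<omega> \<in> space M. emp_quantile_frontier Xs Ys n \<alpha> x \<omega> \<le> y} \<in> events"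
    unfolding le_iff by measurable
qed

text \<open>The event that the quantile is at most \<open>y\<close> and the event of at most \<open>k\<close> exceedances of \<open>y \<ge> 0\<close> differ
only where no sample point lies below \<open>x\<close>.\<close>
lemma order_quantile_df_minus_binomial_cdf_tendsto_0:
  "(\<lambda>n. prob {\<omega> \<in> space M. order_quantile k n \<omega> \<le> y n}
      - (\<Sum>i=0..k. real (n choose i) * exceed_prob (y n) ^ i * (1 - exceed_prob (y n)) ^ (n - i))) \<longlonglongrightarrow> 0"
proof (rule Lim_null_comparison)
  let ?p = "measure Q {(a, b). a \<le> x}"
  show "(\<lambda>n. (1 - ?p) ^ n) \<longlonglongrightarrow> 0"
    using below_pos prob_space.prob_le_1[OF prob_space_Q] by (intro LIMSEQ_power_zero) auto
  show "\<forall>\<^sub>F n in sequentially. norm (prob {\<omega> \<in> space M. order_quantile k n \<omega> \<le> y n}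
      - (\<Sum>i=0..k. real (n choose i) * exceed_prob (y n) ^ i * (1 - exceed_prob (y n)) ^ (n - i))) \<le> (1 - ?p) ^ n"
    \<comment> \<open>for \<open>y n < 0\<close> the binomial sum has parameter 1 and vanishes only when \<open>n > k\<close>\<close>
    using eventually_gt_at_top[of k]
  proof eventually_elim
    case (elim n)
    let ?A = "{\<omega> \<in> space M. order_quantile k n \<omega> \<le> y n}"
    let ?B = "{\<omega> \<in> space M. 0 \<le> y n \<and> num_exceed Xs Ys n x (y n) \<omega> \<le> k}"
    let ?Z = "{\<omega> \<in> space M. num_below Xs n x \<omega> = 0}"
    have events: "?A \<in> events" "?B \<in> events" "?Z \<in> events" by measurable
    have "?A \<subseteq> ?B \<union> ?Z" "?B \<subseteq> ?A \<union> ?Z" using order_quantile_le_iff by auto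
    then have "prob ?A \<le> prob ?B + prob ?Z" "prob ?B \<le> prob ?A + prob ?Z"
      using events by (auto intro!: order_trans[OF finite_measure_mono measure_Un_le])
    moreover have "prob ?B = (\<Sum>i=0..k. real (n choose i) * exceed_prob (y n) ^ i * (1 - exceed_prob (y n)) ^ (n - i))"
    proof (cases "0 \<le> y n")
      case True
      then show ?thesis using prob_num_exceed_le[OF True] by simp
    next
      case False
      with elim have "(\<Sum>i=0..k. real (n choose i) * exceed_prob (y n) ^ i * (1 - exceed_prob (y n)) ^ (n - i)) = 0"
        by (intro sum.neutral) (auto simp: exceed_prob_def)
      with False show ?thesis by simp
    qed
    ultimately show ?case using prob_num_below_0[of n] by (simp add: abs_le_iff)
  qed
qed

lemma FDH_df_tendsto_iff:
  "(\<lambda>n. prob {\<omega> \<in> space M. order_quantile 0 n \<omega> \<le> y n}) \<longlonglongrightarrow> g \<longleftrightarrow>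
   (\<lambda>n. (1 - exceed_prob (y n)) ^ n) \<longlonglongrightarrow> g"
  using Lim_transform_eq[OF order_quantile_df_minus_binomial_cdf_tendsto_0[of 0 y]] by simp

text \<open>The limit of the FDH distribution functions determines the limiting mean number of exceedances, and
through it the limit for every \<open>k\<close>.\<close>
lemma order_quantile_df_tendsto:
  assumes "(\<lambda>n. prob {\<omega> \<in> space M. order_quantile 0 n \<omega> \<le> y n}) \<longlonglongrightarrow> g"
  shows "(\<lambda>n. prob {\<omega> \<in> space M. order_quantile k n \<omega> \<le> y n}) \<longlonglongrightarrow> poisson_transform k g"
proof -
  have "(\<lambda>n. \<Sum>i=0..k. real (n choose i) * exceed_prob (y n) ^ i * (1 - exceed_prob (y n)) ^ (n - i))
      \<longlonglongrightarrow> poisson_transform k g"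
    using assms exceed_prob_bounds
    by (intro binomial_cdf_tendsto_poisson_transform) (simp_all add: FDH_df_tendsto_iff)
  then show ?thesis
    using Lim_transform_eq[OF order_quantile_df_minus_binomial_cdf_tendsto_0[of k y]] by simp
qed

text \<open>Suppose \<open>b\<^sub>n \<ge> 1\<close> infinitely often. Sample points below \<open>x\<close> almost surely do not exceed \<open>\<phi>\<close>, so \<open>G = 1\<close> at
positive continuity points. For \<open>t < 0\<close> the threshold \<open>\<phi> + b\<^sub>n t\<close> is infinitely often at most \<open>\<phi> + t\<close>, so the
FDH estimator stays below it with probability at most about \<open>(1 - q)\<^sup>n\<close>, where \<open>q > 0\<close> is the value of
\<open>exceed_prob\<close> at \<open>\<phi> + t\<close>. So \<open>G = 0\<close> at negative continuity points, and \<open>G\<close> would be degenerate.\<close>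
lemma scale_eventually_less_1:
  assumes pos: "\<And>y. 0 \<le> y \<Longrightarrow> y < \<phi> \<Longrightarrow> exceed_prob y > 0"
    and zero: "\<And>y. \<phi> < y \<Longrightarrow> exceed_prob y = 0"
    and b: "\<And>n. b n > 0"
    and G: "distribution_function G" "non_degenerate G"
    and lim: "\<And>t. isCont G t \<Longrightarrow> (\<lambda>n. prob {\<omega> \<in> space M. order_quantile 0 n \<omega> \<le> \<phi> + b n * t}) \<longlonglongrightarrow> G t"
  shows "\<forall>\<^sub>F n in sequentially. b n < 1"
proof (rule ccontr)
  assume "\<not> ?thesis"
  then have freq: "\<exists>\<^sub>F n in sequentially. 1 \<le> b n"
    by (simp add: frequently_def not_le)
  obtain t where t: "isCont G t" and cases: "t > 0 \<and> G t \<noteq> 1 \<or> t < 0 \<and> G t \<noteq> 0"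
    using non_degenerate_continuity_point[OF G] by blast
  have lim': "(\<lambda>n. (1 - exceed_prob (\<phi> + b n * t)) ^ n) \<longlonglongrightarrow> G t"
    using lim[OF t] by (simp add: FDH_df_tendsto_iff)
  from cases show False
  proof
    assume "t > 0 \<and> G t \<noteq> 1"
    then have "(\<lambda>n. (1 - exceed_prob (\<phi> + b n * t)) ^ n) = (\<lambda>n. 1)"
      using b zero by (auto simp: fun_eq_iff)
    with lim' have "G t = 1" by (simp add: LIMSEQ_const_iff)
    with \<open>t > 0 \<and> G t \<noteq> 1\<close> show False by simp
  next
    assume neg: "t < 0 \<and> G t \<noteq> 0"
    let ?r = "1 - exceed_prob (\<phi> + t)"
    have "exceed_prob (\<phi> + t) > 0"
      using pos[of "\<phi> + t"] neg by (cases "0 \<le> \<phi> + t") (auto simp: exceed_prob_def)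
    then have "(\<lambda>n. ?r ^ n) \<longlonglongrightarrow> 0"
      using exceed_prob_bounds[of "\<phi> + t"] by (intro LIMSEQ_power_zero) auto
    moreover have "G t > 0" using neg distribution_functionD(2)[OF G(1), of t] by simp
    ultimately have "\<forall>\<^sub>F n in sequentially. ?r ^ n < G t / 2" by (intro order_tendstoD) auto
    moreover have "\<forall>\<^sub>F n in sequentially. (1 - exceed_prob (\<phi> + b n * t)) ^ n > G t / 2"
      using lim' \<open>G t > 0\<close> by (intro order_tendstoD) auto
    ultimately have "\<forall>\<^sub>F n in sequentially. \<not> 1 \<le> b n"
    proof eventually_elim
      case (elim n)
      show ?case
      proof
        assume "1 \<le> b n"
        with neg have "b n * t \<le> t" by (simp add: mult_le_cancel_right2)
        then have "(1 - exceed_prob (\<phi> + b n * t)) ^ n \<le> ?r ^ n"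
          using exceed_prob_bounds exceed_prob_antimono by (intro power_mono) auto
        with elim show False by simp
      qed
    qed
    with freq show False by (simp add: frequently_def)
  qed
qed

end

section \<open>Convergence of the frontier estimators\<close>

lemma converges_in_distribution_scaled_iff:
  assumes b: "\<And>n. b n > (0::real)" and T: "\<And>n. T n \<in> borel_measurable M"
  shows "converges_in_distribution M (\<lambda>n \<omega>. inverse (b n) * (T n \<omega> - \<phi>)) G \<longleftrightarrow>
    distribution_function G \<and>
    (\<forall>t. isCont G t \<longrightarrow> (\<lambda>n. measure M {\<omega> \<in> space M. T n \<omega> \<le> \<phi> + b n * t}) \<longlonglongrightarrow> G t)"
proof -
  have meas: "(\<lambda>\<omega>. inverse (b n) * (T n \<omega> - \<phi>)) \<in> borel_measurable M" for n
    using T by measurable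
  have "cdf (distr M borel (\<lambda>\<omega>. inverse (b n) * (T n \<omega> - \<phi>))) t
      = measure M {\<omega> \<in> space M. T n \<omega> \<le> \<phi> + b n * t}" for n t
  proof -
    have "inverse (b n) * (T n \<omega> - \<phi>) \<le> t \<longleftrightarrow> T n \<omega> \<le> \<phi> + b n * t" for \<omega>
      using b[of n] by (simp add: field_simps)
    then show ?thesis
      by (simp add: cdf_def measure_distr[OF meas] vimage_def Int_def conj_commute)
  qed
  then show ?thesis
    using meas by (simp add: converges_in_distribution_def weak_conv_def)
qed

lemma exceed_measure_eq_df_diff:
  assumes "prob_space M" "X \<in> borel_measurable M" "Y \<in> borel_measurable M"
  shows "measure (distr M borel (\<lambda>\<omega>. (X \<omega>, Y \<omega>))) {(a, b). a \<le> x \<and> y < b}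
    = marginal_df M X x - joint_df M X Y x y"
proof -
  interpret prob_space M by fact
  have XY: "(\<lambda>\<omega>. (X \<omega>, Y \<omega>)) \<in> borel_measurable M"
    using assms by (intro borel_measurable_Pair)
  have 1: "(\<lambda>\<omega>. (X \<omega>, Y \<omega>)) -` {(a, b). a \<le> x \<and> y < b} \<inter> space M = {\<omega> \<in> space M. X \<omega> \<le> x \<and> y < Y \<omega>}"
    and 2: "(\<lambda>\<omega>. (X \<omega>, Y \<omega>)) -` {(a, b). a \<le> x} \<inter> space M = {\<omega> \<in> space M. X \<omega> \<le> x}"
    by auto
  have E: "{\<omega> \<in> space M. X \<omega> \<le> x \<and> y < Y \<omega>} \<in> events" "{\<omega> \<in> space M. X \<omega> \<le> x} \<in> events"
    using measurable_sets[OF XY borel_exceed[of x y]] measurable_sets[OF XY borel_below[of x]] unfolding 1 2 .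
  have "{\<omega> \<in> space M. X \<omega> \<le> x \<and> Y \<omega> \<le> y} = {\<omega> \<in> space M. X \<omega> \<le> x} - {\<omega> \<in> space M. X \<omega> \<le> x \<and> y < Y \<omega>}"
    by auto
  then have "joint_df M X Y x y = marginal_df M X x - prob {\<omega> \<in> space M. X \<omega> \<le> x \<and> y < Y \<omega>}"
    unfolding joint_df_def marginal_df_def using E by (simp only:) (intro finite_measure_Diff, auto)
  then show ?thesis by (simp only: measure_distr[OF XY borel_exceed] 1)
qed

theorem theorem2p2:
  fixes M :: "'a measure"
    and X :: "'a \<Rightarrow> real ^ 'p" and Y :: "'a \<Rightarrow> real"
    and Xs :: "nat \<Rightarrow> 'a \<Rightarrow> real ^ 'p" and Ys :: "nat \<Rightarrow> 'a \<Rightarrow> real"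
    and x :: "real ^ 'p" and b :: "nat \<Rightarrow> real" and G :: "real \<Rightarrow> real"
  assumes "prob_space M"
    and "X \<in> borel_measurable M" and "Y \<in> borel_measurable M"
    and "\<And>\<omega>. \<omega> \<in> space M \<Longrightarrow> 0 \<le> X \<omega>" and "\<And>\<omega>. \<omega> \<in> space M \<Longrightarrow> 0 \<le> Y \<omega>"
    and "prob_space.indep_vars M (\<lambda>_. borel) (\<lambda>i \<omega>. (Xs i \<omega>, Ys i \<omega>)) {1..}"
    and "\<And>i. i \<ge> 1 \<Longrightarrow>
           distr M borel (\<lambda>\<omega>. (Xs i \<omega>, Ys i \<omega>)) = distr M borel (\<lambda>\<omega>. (X \<omega>, Y \<omega>))"
    and "0 \<le> x" and "marginal_df M X x > 0"
    and "frontier_fun M X Y x < \<infinity>"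
    and "\<And>n. b n > 0"
    and "distribution_function G" and "non_degenerate G"
    and "converges_in_distribution M
           (\<lambda>n \<omega>. inverse (b n) *
              (emp_quantile_frontier Xs Ys n 1 x \<omega> - enn2real (frontier_fun M X Y x))) G"
  shows "(\<forall>k::nat.
            converges_in_distribution M
              (\<lambda>n \<omega>. inverse (b n) *
                 (emp_quantile_frontier Xs Ys n
                    (1 - real k / (real n * emp_marginal_df Xs n \<omega> x)) x \<omega>
                  - enn2real (frontier_fun M X Y x)))
              (poisson_limit_df k G)) \<and>
         (bdd_above (distr_support M Y) \<longrightarrow>
           (\<forall>\<alpha>::nat \<Rightarrow> real.
              (\<forall>n. 0 < \<alpha> n \<and> \<alpha> n \<le> 1) \<and> \<alpha> \<longlonglongrightarrow> 1 \<and>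
              (\<lambda>n. real n * inverse (b n) * (1 - \<alpha> n)) \<longlonglongrightarrow> 0 \<longrightarrow>
              converges_in_distribution M
                (\<lambda>n \<omega>. inverse (b n) *
                   (emp_quantile_frontier Xs Ys n (\<alpha> n) x \<omega>
                    - enn2real (frontier_fun M X Y x))) G))"
proof -
  interpret prob_space M by fact
  define Q where "Q = distr M borel (\<lambda>\<omega>. (X \<omega>, Y \<omega>))"
  define \<phi> where "\<phi> = enn2real (frontier_fun M X Y x)"
  have XY: "(\<lambda>\<omega>. (X \<omega>, Y \<omega>)) \<in> borel_measurable M"
    using assms(2,3) by (intro borel_measurable_Pair)
  have below: "measure Q {(a, b). a \<le> x} = marginal_df M X x"
    unfolding Q_def measure_distr[OF XY borel_below] marginal_df_def
    by (intro arg_cong[where f=prob]) auto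
  interpret iid_sample M Xs Ys Q x
    by unfold_locales (use assms(6,7,9) below in \<open>auto simp: Q_def\<close>)
  have exceed: "exceed_prob y = marginal_df M X x - joint_df M X Y x y" if "0 \<le> y" for y
    using that exceed_measure_eq_df_diff[OF assms(1-3), of x y, folded Q_def] by (simp only: exceed_prob_def if_True)
  have cond: "cond_df M X Y x y < 1 \<longleftrightarrow> exceed_prob y > 0" if "0 \<le> y" for y
    using exceed[OF that] assms(9) by (simp add: cond_df_def)
  have \<phi>: "ennreal \<phi> = (SUP y \<in> {y. 0 \<le> y \<and> cond_df M X Y x y < 1}. ennreal y)" "0 \<le> \<phi>"
    using assms(10) by (simp_all add: \<phi>_def frontier_fun_def)
  have pos: "exceed_prob y > 0" if y: "0 \<le> y" "y < \<phi>" for y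
  proof -
    have "ennreal y < (SUP y \<in> {y. 0 \<le> y \<and> cond_df M X Y x y < 1}. ennreal y)"
      unfolding \<phi>(1)[symmetric] using y by (simp add: ennreal_less_iff)
    then obtain z where "0 \<le> z" "cond_df M X Y x z < 1" "ennreal y < ennreal z"
      by (auto simp: less_SUP_iff)
    with y cond[of z] exceed_prob_antimono[of y z] show ?thesis by (simp add: ennreal_less_iff)
  qed
  have zero: "exceed_prob y = 0" if y: "\<phi> < y" for y
  proof (rule ccontr)
    assume "exceed_prob y \<noteq> 0"
    with exceed_prob_bounds[of y] cond[of y] y \<phi>(2) have "y \<in> {y. 0 \<le> y \<and> cond_df M X Y x y < 1}" by simp
    then have "ennreal y \<le> ennreal \<phi>" unfolding \<phi>(1) by (rule SUP_upper)
    with y \<phi>(2) show False by simp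
  qed
  have FDH: "emp_quantile_frontier Xs Ys n 1 x = order_quantile 0 n" for n
    by (simp add: order_quantile_def fun_eq_iff)
  have conv_iff: "converges_in_distribution M (\<lambda>n \<omega>. inverse (b n) * (T n \<omega> - \<phi>)) H \<longleftrightarrow>
      distribution_function H \<and>
      (\<forall>t. isCont H t \<longrightarrow> (\<lambda>n. prob {\<omega> \<in> space M. T n \<omega> \<le> \<phi> + b n * t}) \<longlonglongrightarrow> H t)"
    if "\<And>n. T n \<in> borel_measurable M" for T :: "nat \<Rightarrow> 'a \<Rightarrow> real" and H
    using converges_in_distribution_scaled_iff[OF assms(11) that] .
  have lim: "(\<lambda>n. prob {\<omega> \<in> space M. order_quantile 0 n \<omega> \<le> \<phi> + b n * t}) \<longlonglongrightarrow> G t" if "isCont G t" for t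
    using assms(14) that
    unfolding \<phi>_def[symmetric] FDH by (subst (asm) conv_iff) auto
  have part_i: "converges_in_distribution M (\<lambda>n \<omega>. inverse (b n) * (order_quantile k n \<omega> - \<phi>)) (poisson_limit_df k G)" for k
    unfolding conv_iff[OF measurable_order_quantile]
  proof (intro conjI allI impI)
    show "distribution_function (poisson_limit_df k G)"
      by (rule distribution_function_poisson_limit_df) fact
    fix t assume "isCont (poisson_limit_df k G) t"
    then have "isCont G t" by (rule isCont_poisson_limit_dfD[OF assms(12)])
    from order_quantile_df_tendsto[OF lim[OF this]]
    show "(\<lambda>n. prob {\<omega> \<in> space M. order_quantile k n \<omega> \<le> \<phi> + b n * t}) \<longlonglongrightarrow> poisson_limit_df k G t"
      by (simp add: poisson_limit_df_eq_transform)
  qed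
  have part_ii: "converges_in_distribution M
      (\<lambda>n \<omega>. inverse (b n) * (emp_quantile_frontier Xs Ys n (\<alpha> n) x \<omega> - \<phi>)) G"
    if \<alpha>: "\<And>n. 0 < \<alpha> n" "\<And>n. \<alpha> n \<le> 1"
      and rate: "(\<lambda>n. real n * inverse (b n) * (1 - \<alpha> n)) \<longlonglongrightarrow> 0" for \<alpha>
  proof -
    have meas: "emp_quantile_frontier Xs Ys n (\<alpha> n) x \<in> borel_measurable M" for n
      using \<alpha> by (rule measurable_emp_quantile_frontier)
    have "\<forall>\<^sub>F n in sequentially. b n < 1"
      by (rule scale_eventually_less_1[OF pos zero assms(11-13) lim])
    moreover have "\<forall>\<^sub>F n in sequentially. real n * inverse (b n) * (1 - \<alpha> n) < 1"
      using order_tendstoD(2)[OF rate, of 1] by simp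
    ultimately have eq: "\<forall>\<^sub>F n in sequentially. emp_quantile_frontier Xs Ys n (\<alpha> n) x = order_quantile 0 n"
    proof eventually_elim
      case (elim n)
      have "real n * (1 - \<alpha> n) < b n"
        using elim(2) assms(11)[of n] by (simp add: field_simps)
      with elim(1) have "real n * (1 - \<alpha> n) < 1" by simp
      then show ?case unfolding FDH[symmetric] by (intro ext emp_quantile_frontier_eq_FDH \<alpha>)
    qed
    show ?thesis
      unfolding conv_iff[OF meas]
    proof (intro conjI allI impI assms(12))
      fix t assume "isCont G t"
      from lim[OF this]
      show "(\<lambda>n. prob {\<omega> \<in> space M. emp_quantile_frontier Xs Ys n (\<alpha> n) x \<omega> \<le> \<phi> + b n * t}) \<longlonglongrightarrow> G t"
        by (rule Lim_transform_eventually) (use eq in eventually_elim, simp)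
    qed
  qed
  show ?thesis
    using part_i part_ii unfolding \<phi>_def order_quantile_def by blast
qed

end
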